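(* Let $X$ be a complex Banach space, let $U$ be an open, connected subset of $\mathbb{C}$ with $0\in U$, and let $T\in C(X)$ possess an analytic generalized inverse $R(\lambda)=\sum_{n=0}^\infty\lambda^nT_n$ (with $T_n\in B(X)$) on $U$. For $\lambda\in U$ denote $P(\lambda)=(T-\lambda I)R(\lambda)$ and $Q(\lambda)=R(\lambda)(T-\lambda I)$. The following conditions are equivalent: (i) $T_n=T_0^{n+1}$ for all $n\ge 1$. (ii) $\ker(P(\lambda))=\ker(TT_0)$ and $\operatorname{ran}(Q(\lambda))=\operatorname{ran}(T_0T)$ for all $\lambda\in U$. (iii) There exist two closed subspaces $Z$ and $W$ of $X$ such that $\ker(P(\lambda))=Z$ and $\operatorname{ran}(Q(\lambda))=W$ for all $\lambda\in U$. (iv) $R(\lambda)$ is a generalized resolvent of $T$ on $U$. (v) $R(\lambda)-R(0)=\lambda R(\lambda)R(0)$ for all $\lambda\in U$.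
   Context: $C(X)$ is the set of closed, densely defined linear operators $T: D(T)\subseteq X\to X$, and $B(X)$ is the algebra of bounded linear operators on $X$. $\ker$ and $\operatorname{ran}$ denote kernel and range; $I$ is the identity. A generalized inverse of $T\in C(X)$ is an operator $S\in B(X)$ with $\operatorname{ran}(S)\subseteq D(T)$ such that $TST=T$ on $D(T)$, $STS=S$ on $X$, and $ST$ (defined on $D(T)$) is continuous. In that case $TS$ is a bounded projection, and $ST$ extends uniquely to a bounded projection on $X$ with kernel $\ker(T)$ and range $\overline{\operatorname{ran}(S)}$. By convention the notation $ST$ stands for this bounded extension; thus $Q(\lambda)$ and $T_0T$ denote the bounded projections on $X$ extending the corresponding products. An analytic generalized inverse of $T$ on $U$ is an analytic function $R:U\to B(X)$ such that $R(\lambda)$ is a generalized inverse of $T-\lambda I$ for every $\lambda\in U$; here it is assumed to be given on $U$ by the norm-convergent power series $\sum_{n\ge0}\lambda^nT_n$. A generalized resolvent of $T$ on a connected open set $U$ is a function $R:U\to B(X)$ such that $R(\lambda)$ is a generalized inverse of $T-\lambda I$ for every $\lambda\in U$ and $R(\lambda)-R(\mu)=(\lambda-\mu)R(\lambda)R(\mu)$ for all $\lambda,\mu\in U$. *)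

theory Defs
  imports "HOL-Analysis.Analysis"
begin

section \<open>Complex Banach spaces\<close>

class scaleC = scaleR +
  fixes scaleC :: "complex \<Rightarrow> 'a \<Rightarrow> 'a" (infixr \<open>*\<^sub>C\<close> 75)
  assumes scaleR_scaleC: "r *\<^sub>R x = complex_of_real r *\<^sub>C x"

class complex_vector = scaleC + ab_group_add +
  assumes scaleC_add_right: "a *\<^sub>C (x + y) = a *\<^sub>C x + a *\<^sub>C y"
    and scaleC_add_left: "(a + b) *\<^sub>C x = a *\<^sub>C x + b *\<^sub>C x"
    and scaleC_scaleC: "a *\<^sub>C b *\<^sub>C x = (a * b) *\<^sub>C x"
    and scaleC_one: "1 *\<^sub>C x = x"

text \<open>The norm, metric and topology are those of the underlying real normed space.\<close>

class complex_normed_vector = complex_vector + real_normed_vector +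
  assumes norm_scaleC: "norm (a *\<^sub>C x) = cmod a * norm x"

class complex_banach = complex_normed_vector + complete_space

subclass (in complex_banach) banach ..

instantiation complex :: complex_banach
begin
definition scaleC_complex :: "complex \<Rightarrow> complex \<Rightarrow> complex"
  where "scaleC_complex c z = c * z"
instance
  by standard (auto simp: scaleC_complex_def scaleR_conv_of_real algebra_simps norm_mult)
end

global_interpretation complex_vector: vector_space "scaleC :: complex \<Rightarrow> 'a::complex_vector \<Rightarrow> 'a"
  by unfold_locales (simp_all add: scaleC_add_right scaleC_add_left scaleC_scaleC scaleC_one)

abbreviation csubspace :: "'a::complex_vector set \<Rightarrow> bool"
  where "csubspace \<equiv> module.subspace scaleC"

lemma bounded_linear_scaleC_right: "bounded_linear (\<lambda>x::'a::complex_normed_vector. c *\<^sub>C x)"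
  by (rule bounded_linear_intro[where K = "cmod c"])
    (simp_all add: scaleC_add_right scaleR_scaleC scaleC_scaleC mult.commute norm_scaleC)

instantiation blinfun :: (real_normed_vector, complex_normed_vector) complex_normed_vector
begin

lift_definition scaleC_blinfun :: "complex \<Rightarrow> 'a \<Rightarrow>\<^sub>L 'b \<Rightarrow> 'a \<Rightarrow>\<^sub>L 'b"
  is "\<lambda>c f x. c *\<^sub>C f x"
  by (rule bounded_linear_compose[OF bounded_linear_scaleC_right])

instance
proof
  fix r :: real and a b :: complex and f g :: "'a \<Rightarrow>\<^sub>L 'b"
  show "r *\<^sub>R f = complex_of_real r *\<^sub>C f"
    by transfer (simp add: scaleR_scaleC)
  show "a *\<^sub>C (f + g) = a *\<^sub>C f + a *\<^sub>C g"
    by transfer (simp add: scaleC_add_right)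
  show "(a + b) *\<^sub>C f = a *\<^sub>C f + b *\<^sub>C f"
    by transfer (simp add: scaleC_add_left)
  show "a *\<^sub>C b *\<^sub>C f = (a * b) *\<^sub>C f"
    by transfer (simp add: scaleC_scaleC)
  show "1 *\<^sub>C f = f"
    by transfer (simp add: scaleC_one)
  have le: "norm (c *\<^sub>C h) \<le> cmod c * norm h" for c and h :: "'a \<Rightarrow>\<^sub>L 'b"
    by (rule norm_blinfun_bound)
      (auto simp: scaleC_blinfun.rep_eq norm_scaleC mult.assoc intro!: mult_left_mono norm_blinfun)
  show "norm (a *\<^sub>C f) = cmod a * norm f"
  proof (cases "a = 0")
    case True
    then show ?thesis using le[of a f] by simp
  next
    case False
    have "inverse a *\<^sub>C a *\<^sub>C f = f"
      using False by transfer (simp add: scaleC_scaleC scaleC_one)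
    then have "norm f \<le> cmod (inverse a) * norm (a *\<^sub>C f)"
      using le[of "inverse a" "a *\<^sub>C f"] by metis
    then have "cmod a * norm f \<le> cmod a * (cmod (inverse a) * norm (a *\<^sub>C f))"
      by (rule mult_left_mono) (rule norm_ge_zero)
    also have "\<dots> = norm (a *\<^sub>C f)"
      using False by (metis mult.assoc mult.left_neutral norm_mult norm_one right_inverse)
    finally have "cmod a * norm f \<le> norm (a *\<^sub>C f)" .
    with le[of a f] show ?thesis by (rule order.antisym)
  qed
qed

end

section \<open>Operators\<close>

text \<open>
  The algebra \<open>B(X)\<close> is the set of complex-linear elements of the type of real-linear bounded
  operators; both carry the operator norm.
\<close>

definition bounded_ops :: "('a::complex_normed_vector \<Rightarrow>\<^sub>L 'a) set"
  where "bounded_ops = {S. \<forall>c x. blinfun_apply S (c *\<^sub>C x) = c *\<^sub>C S x}"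

text \<open>
  An unbounded operator is given by its domain \<open>D\<close> and a function \<open>T\<close>, of which only the values
  on \<open>D\<close> are relevant.
\<close>

definition linear_op_on :: "'a::complex_vector set \<Rightarrow> ('a \<Rightarrow> 'a) \<Rightarrow> bool"
  where "linear_op_on D T \<longleftrightarrow> csubspace D \<and>
    (\<forall>x\<in>D. \<forall>y\<in>D. T (x + y) = T x + T y) \<and> (\<forall>c. \<forall>x\<in>D. T (c *\<^sub>C x) = c *\<^sub>C T x)"

definition closed_densely_defined :: "'a::complex_normed_vector set \<Rightarrow> ('a \<Rightarrow> 'a) \<Rightarrow> bool"
  where "closed_densely_defined D T \<longleftrightarrow>
    linear_op_on D T \<and> closed {(x, T x) |x. x \<in> D} \<and> closure D = UNIV"

text \<open>The operator \<open>T - \<zeta>I\<close>, with the same domain as \<open>T\<close>.\<close>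

definition shift_op :: "('a::complex_vector \<Rightarrow> 'a) \<Rightarrow> complex \<Rightarrow> 'a \<Rightarrow> 'a"
  where "shift_op T \<zeta> = (\<lambda>x. T x - \<zeta> *\<^sub>C x)"

definition kernel :: "('a \<Rightarrow> 'b::zero) \<Rightarrow> 'a set"
  where "kernel f = {x. f x = 0}"

definition generalized_inverse ::
    "'a::complex_normed_vector set \<Rightarrow> ('a \<Rightarrow> 'a) \<Rightarrow> ('a \<Rightarrow>\<^sub>L 'a) \<Rightarrow> bool"
  where "generalized_inverse D T S \<longleftrightarrow>
    S \<in> bounded_ops \<and> range S \<subseteq> D \<and>
    (\<forall>x\<in>D. T (S (T x)) = T x) \<and> (\<forall>x. S (T (S x)) = S x) \<and>
    continuous_on D (\<lambda>x. S (T x))"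

text \<open>
  The unique bounded extension to \<open>X\<close> of an operator defined on \<open>D\<close>; unspecified if there is none.
\<close>

definition bounded_extension ::
    "'a::complex_normed_vector set \<Rightarrow> ('a \<Rightarrow> 'a) \<Rightarrow> 'a \<Rightarrow>\<^sub>L 'a"
  where "bounded_extension D f = (THE G. G \<in> bounded_ops \<and> (\<forall>x\<in>D. blinfun_apply G x = f x))"

text \<open>\<open>P = TS\<close> is defined everywhere; \<open>Q\<close> is the bounded extension of \<open>ST\<close>.\<close>

definition proj_P :: "('a::complex_normed_vector \<Rightarrow> 'a) \<Rightarrow> ('a \<Rightarrow>\<^sub>L 'a) \<Rightarrow> 'a \<Rightarrow> 'a"
  where "proj_P T S = (\<lambda>x. T (S x))"

definition proj_Q ::
    "'a::complex_normed_vector set \<Rightarrow> ('a \<Rightarrow> 'a) \<Rightarrow> ('a \<Rightarrow>\<^sub>L 'a) \<Rightarrow> 'a \<Rightarrow>\<^sub>L 'a"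
  where "proj_Q D T S = bounded_extension D (\<lambda>x. S (T x))"

text \<open>Series of operators are taken with respect to the operator norm.\<close>

definition analytic_operator_function ::
    "complex set \<Rightarrow> (complex \<Rightarrow> 'a::complex_normed_vector \<Rightarrow>\<^sub>L 'a) \<Rightarrow> bool"
  where "analytic_operator_function U R \<longleftrightarrow> R ` U \<subseteq> bounded_ops \<and>
    (\<forall>z\<in>U. \<exists>r>0. \<exists>A. range A \<subseteq> bounded_ops \<and> ball z r \<subseteq> U \<and>
      (\<forall>w\<in>ball z r. (\<lambda>n. (w - z) ^ n *\<^sub>C A n) sums R w))"

definition analytic_generalized_inverse ::
    "complex set \<Rightarrow> 'a::complex_normed_vector set \<Rightarrow> ('a \<Rightarrow> 'a) \<Rightarrow> (complex \<Rightarrow> 'a \<Rightarrow>\<^sub>L 'a) \<Rightarrow> bool"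
  where "analytic_generalized_inverse U D T R \<longleftrightarrow>
    analytic_operator_function U R \<and> (\<forall>\<zeta>\<in>U. generalized_inverse D (shift_op T \<zeta>) (R \<zeta>))"

definition generalized_resolvent ::
    "complex set \<Rightarrow> 'a::complex_normed_vector set \<Rightarrow> ('a \<Rightarrow> 'a) \<Rightarrow> (complex \<Rightarrow> 'a \<Rightarrow>\<^sub>L 'a) \<Rightarrow> bool"
  where "generalized_resolvent U D T R \<longleftrightarrow> open U \<and> connected U \<and>
    (\<forall>\<zeta>\<in>U. generalized_inverse D (shift_op T \<zeta>) (R \<zeta>)) \<and>
    (\<forall>\<zeta>\<in>U. \<forall>\<mu>\<in>U. R \<zeta> - R \<mu> = (\<zeta> - \<mu>) *\<^sub>C (R \<zeta> o\<^sub>L R \<mu>))"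

section \<open>Well-definedness of the bounded extension\<close>

lemma dense_eqI:
  fixes f g :: "'a::topological_space \<Rightarrow> 'b::t2_space"
  assumes "closure D = UNIV" "continuous_on UNIV f" "continuous_on UNIV g" "\<And>x. x \<in> D \<Longrightarrow> f x = g x"
  shows "f x = g x"
proof -
  have "closed {x. f x = g x}" using assms(2,3) by (rule closed_Collect_eq)
  then have "closure D \<subseteq> {x. f x = g x}" using assms(4) by (intro closure_minimal) auto
  then show ?thesis using assms(1) by auto
qed

lemma bounded_extension_ex1:
  fixes f :: "'a::complex_banach \<Rightarrow> 'a"
  assumes lin: "linear_op_on D f" and dense: "closure D = UNIV" and cont: "continuous_on D f"
  shows "\<exists>!G. G \<in> bounded_ops \<and> (\<forall>x\<in>D. blinfun_apply G x = f x)"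
proof (rule ex_ex1I)
  have D0: "0 \<in> D" and Dadd: "\<And>x y. x \<in> D \<Longrightarrow> y \<in> D \<Longrightarrow> x + y \<in> D"
    and Dsc: "\<And>c x. x \<in> D \<Longrightarrow> c *\<^sub>C x \<in> D"
    and fadd: "\<And>x y. x \<in> D \<Longrightarrow> y \<in> D \<Longrightarrow> f (x + y) = f x + f y"
    and fsc: "\<And>c x. x \<in> D \<Longrightarrow> f (c *\<^sub>C x) = c *\<^sub>C f x"
    using lin unfolding linear_op_on_def complex_vector.subspace_def by auto
  have scR: "r *\<^sub>R x \<in> D" "f (r *\<^sub>R x) = r *\<^sub>R f x" if "x \<in> D" for r x
    using that by (simp_all add: scaleR_scaleC Dsc fsc)
  have f0: "f 0 = 0" using scR(2)[OF D0, of 0] by simp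
  have sub: "x - y \<in> D" "f (x - y) = f x - f y" if "x \<in> D" "y \<in> D" for x y
    using Dadd[OF that(1) scR(1)[OF that(2), of "-1"]]
      fadd[OF that(1) scR(1)[OF that(2), of "-1"]] scR(2)[OF that(2), of "-1"] by simp_all
  obtain d where d: "d > 0" "\<And>x. x \<in> D \<Longrightarrow> norm x < d \<Longrightarrow> norm (f x) < 1"
    using cont[unfolded continuous_on_iff, rule_format, OF D0, of 1] by (auto simp: f0)
  have bnd: "norm (f x) \<le> 2 / d * norm x" if "x \<in> D" for x
  proof (cases "x = 0")
    case False
    define r where "r = d / (2 * norm x)"
    have r: "r > 0" "r * norm x < d" using d(1) False by (auto simp: r_def)
    have "norm (f (r *\<^sub>R x)) < 1" using r that by (intro d(2) scR(1)) auto
    then have "r * norm (f x) < 1" using r(1) that by (simp add: scR)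
    then show ?thesis using r(1) False d(1) by (simp add: r_def field_simps)
  qed (simp add: f0)
  have "(2 / d)-lipschitz_on D f"
    using d(1) bnd[OF sub(1)] by (intro lipschitz_onI) (auto simp: dist_norm sub(2))
  then have "uniformly_continuous_on D f" by (rule lipschitz_on_uniformly_continuous)
  then obtain g where g: "uniformly_continuous_on (closure D) g" "\<And>x. x \<in> D \<Longrightarrow> f x = g x"
    by (rule uniformly_continuous_on_extension_on_closure) blast
  have gc: "continuous_on UNIV g" using g(1) dense uniformly_continuous_imp_continuous by metis
  have gc2: "continuous_on UNIV (\<lambda>x. g (h x))" if "continuous_on UNIV h" for h :: "'a \<Rightarrow> 'a"
    using continuous_on_compose2[OF gc that] by auto
  have cC: "continuous_on UNIV (\<lambda>x. c *\<^sub>C h x)" if "continuous_on UNIV h" for c and h :: "'a \<Rightarrow> 'a"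
    using bounded_linear.continuous_on[OF bounded_linear_scaleC_right that] .
  have add1: "g (x + y) = g x + g y" if "y \<in> D" for x y
    by (rule dense_eqI[OF dense, where x = x])
      (auto intro!: continuous_intros gc2 gc simp: that Dadd fadd simp flip: g(2))
  have add: "g (x + y) = g x + g y" for x y
    by (rule dense_eqI[OF dense, where x = y]) (auto intro!: continuous_intros gc2 gc simp: add1)
  have sc: "g (c *\<^sub>C x) = c *\<^sub>C g x" for c x
    by (rule dense_eqI[OF dense, where x = x])
      (auto intro!: gc2 cC gc continuous_intros simp: Dsc fsc simp flip: g(2))
  have "closed {x. norm (g x) \<le> 2 / d * norm x}"
    by (intro closed_Collect_le continuous_intros gc)
  then have "closure D \<subseteq> {x. norm (g x) \<le> 2 / d * norm x}"
    using bnd g(2) by (intro closure_minimal) auto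
  then have "norm (g x) \<le> norm x * (2 / d)" for x using dense by (auto simp: mult.commute)
  then have "bounded_linear g"
    using add sc by (intro bounded_linear_intro[of g "2 / d"]) (simp_all only: scaleR_scaleC)
  then show "\<exists>G. G \<in> bounded_ops \<and> (\<forall>x\<in>D. blinfun_apply G x = f x)"
    by (intro exI[of _ "Blinfun g"]) (auto simp: bounded_ops_def bounded_linear_Blinfun_apply sc g(2))
next
  fix G H :: "'a \<Rightarrow>\<^sub>L 'a"
  assume "G \<in> bounded_ops \<and> (\<forall>x\<in>D. G x = f x)" "H \<in> bounded_ops \<and> (\<forall>x\<in>D. H x = f x)"
  then show "G = H"
    by - (rule blinfun_eqI, rule dense_eqI[OF dense],
        auto intro!: linear_continuous_on blinfun.bounded_linear_right)
qed

lemma proj_Q_props: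
  fixes T :: "'a::complex_banach \<Rightarrow> 'a"
  assumes lin: "linear_op_on D T" and dense: "closure D = UNIV" and S: "generalized_inverse D T S"
  shows "proj_Q D T S \<in> bounded_ops" and "x \<in> D \<Longrightarrow> proj_Q D T S x = S (T x)"
proof -
  have "linear_op_on D (\<lambda>x. S (T x))"
    using lin S by (auto simp: linear_op_on_def generalized_inverse_def bounded_ops_def blinfun.add_right)
  with dense S have "\<exists>!G. G \<in> bounded_ops \<and> (\<forall>x\<in>D. blinfun_apply G x = S (T x))"
    by (intro bounded_extension_ex1) (auto simp: generalized_inverse_def)
  from theI'[OF this] show "proj_Q D T S \<in> bounded_ops" "x \<in> D \<Longrightarrow> proj_Q D T S x = S (T x)"
    unfolding proj_Q_def bounded_extension_def by auto
qed

end

theory Submission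
  imports Defs
begin

text \<open>
  If \<open>S\<close> is a generalized inverse of \<open>T - \<zeta>I\<close>, then \<open>(T - \<zeta>I)S\<close> has the same kernel as \<open>S\<close>, and the
  extension of \<open>S(T - \<zeta>I)\<close> has as range the closure of \<open>ran S\<close>. If these subspaces do not depend on
  \<open>\<zeta>\<close>, then \<open>R(\<zeta>)(T - \<mu>I)R(\<mu>) = R(\<zeta>)\<close> and \<open>R(\<zeta>)(T - \<zeta>I)R(\<mu>) = R(\<mu>)\<close>; subtracting gives the
  resolvent identity. Conversely, the resolvent identity factors each of \<open>R(\<zeta>)\<close>, \<open>R(\<mu>)\<close> through the
  other on both sides, so kernels and ranges agree. Comparing coefficients turns (v) into
  \<open>T\<^sub>n\<^sub>+\<^sub>1 = T\<^sub>nT\<^sub>0\<close>, which is (i). From (i), \<open>R(\<zeta>) - R(0)\<close> equals both \<open>\<zeta>R(\<zeta>)R(0)\<close> and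
  \<open>\<zeta>R(0)R(\<zeta>)\<close>, and the full resolvent identity follows from these two by algebra.
\<close>

section \<open>Uniqueness of power series coefficients\<close>

text \<open>Strong induction: once all lower coefficients vanish, the term of index \<open>n\<close>
  at a real point \<open>t > 0\<close> is minus the tail, which is of order t^(n+1). Dividing by t^n
  and letting \<open>t\<close> tend to 0 forces \<open>a n = 0\<close>.\<close>

lemma powser_eq_zero_imp_coeff_eq_zero:
  fixes a :: "nat \<Rightarrow> 'a::{complex_normed_vector,banach}"
  assumes r: "r > 0" and zero: "\<And>z. z \<in> ball 0 r \<Longrightarrow> (\<lambda>n. z ^ n *\<^sub>C a n) sums 0"
  shows "a n = 0"
proof -
  define s where "s = r / 2"
  have s: "s > 0" "s < r" using r by (auto simp: s_def)
  \<comment> \<open>Convergence at the single point \<open>s\<close> inside the ball makes the terms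
    bounded there, which gives a Cauchy-type estimate for every coefficient.\<close>
  have "(\<lambda>n. complex_of_real s ^ n *\<^sub>C a n) \<longlonglongrightarrow> 0"
    using zero[of "complex_of_real s"] s by (intro summable_LIMSEQ_zero) (auto simp: sums_iff)
  then have "Bseq (\<lambda>n. complex_of_real s ^ n *\<^sub>C a n)"
    by (intro convergent_imp_Bseq) (auto simp: convergent_def)
  then obtain C where C: "C > 0" "\<And>n. norm (complex_of_real s ^ n *\<^sub>C a n) \<le> C"
    by (auto simp: Bseq_def)
  have bound: "s ^ n * norm (a n) \<le> C" for n
    using C(2)[of n] s by (simp add: norm_scaleC norm_power)
  show ?thesis
  proof (induction n rule: less_induct)
    case (less n)
    \<comment> \<open>The tail is dominated by a geometric series of ratio \<open>t / s\<close>. The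
      factor 2 bounds \<open>1 / (1 - t / s)\<close> for \<open>t \<le> s / 2\<close>.\<close>
    define K where "K = 2 * C / s ^ Suc n"
    have le: "norm (a n) \<le> t * K" if t: "0 < t" "t \<le> s / 2" for t
    proof -
      define f where "f = (\<lambda>m. complex_of_real t ^ m *\<^sub>C a m)"
      have "f sums 0" using zero[of "complex_of_real t"] t s by (simp add: f_def)
      then have "(\<lambda>i. f (i + Suc n)) sums (0 - (\<Sum>i<Suc n. f i))"
        by (rule sums_split_initial_segment)
      moreover have "(\<Sum>i<n. f i) = 0"
        using less by (intro sum.neutral) (auto simp: f_def)
      ultimately have sums: "(\<lambda>i. f (i + Suc n)) sums (- f n)" by simp
      have q: "0 < t / s" "t / s \<le> 1 / 2" using t s by (auto simp: field_simps)
      have geo: "(\<lambda>i. C * (t / s) ^ Suc n * (t / s) ^ i) sums (C * (t / s) ^ Suc n * (1 / (1 - t / s)))"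
        using q t s by (intro sums_mult geometric_sums) simp
      have "norm (f (i + Suc n)) \<le> C * (t / s) ^ Suc n * (t / s) ^ i" for i
      proof -
        have "norm (f (i + Suc n)) = (t / s) ^ (i + Suc n) * (s ^ (i + Suc n) * norm (a (i + Suc n)))"
          using t s by (simp add: f_def norm_scaleC norm_power norm_mult power_divide)
        also have "\<dots> \<le> (t / s) ^ (i + Suc n) * C"
          using q(1) by (intro mult_left_mono[OF bound] zero_le_power) simp
        finally show ?thesis by (simp add: power_add mult_ac)
      qed
      then have "norm (- f n) \<le> C * (t / s) ^ Suc n * (1 / (1 - t / s))"
        by (intro norm_sums_le[OF sums geo])
      also have "\<dots> \<le> C * (t / s) ^ Suc n * 2"
      proof (rule mult_left_mono)
        have "1 / 2 \<le> 1 - t / s" using q(2) by linarith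
        then have "1 / (1 - t / s) \<le> 1 / (1 / 2)" by (intro frac_le) simp_all
        then show "1 / (1 - t / s) \<le> 2" by simp
        show "0 \<le> C * (t / s) ^ Suc n" using C(1) q(1) by (simp del: power_Suc)
      qed
      finally have "t ^ n * norm (a n) \<le> t ^ n * (t * K)"
        using t by (simp add: f_def norm_scaleC norm_power K_def power_divide mult_ac)
      then show ?thesis using t by simp
    qed
    have "norm (a n) \<le> 0"
    proof (rule tendsto_lowerbound)
      show "((\<lambda>t. t * K) \<longlongrightarrow> 0) (at_right 0)" by (auto intro!: tendsto_eq_intros)
      show "\<forall>\<^sub>F t in at_right 0. norm (a n) \<le> t * K"
        using eventually_at_right_real[of 0 "s / 2"] s le by (auto elim!: eventually_mono)
    qed simp
    then show ?case by simp
  qed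
qed

section \<open>Kernels and ranges attached to a generalized inverse\<close>

lemma linear_op_on_shift_op:
  "linear_op_on D T \<Longrightarrow> linear_op_on D (shift_op T \<zeta>)"
  by (auto simp: linear_op_on_def shift_op_def scaleC_add_right scaleC_scaleC mult.commute
      complex_vector.scale_right_diff_distrib)

lemma shift_op_0: "shift_op T 0 = T"
  by (simp add: shift_op_def)

lemma generalized_inverse_bounded_ops: "generalized_inverse D T S \<Longrightarrow> S \<in> bounded_ops"
  and generalized_inverse_in_domain: "generalized_inverse D T S \<Longrightarrow> S x \<in> D"
  and generalized_inverse_inner: "generalized_inverse D T S \<Longrightarrow> S (T (S x)) = S x"
  by (auto simp: generalized_inverse_def)

lemma bounded_ops_scaleC: "S \<in> bounded_ops \<Longrightarrow> blinfun_apply S (c *\<^sub>C x) = c *\<^sub>C S x"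
  by (simp add: bounded_ops_def)

lemma kernel_blinfun_closed_csubspace:
  fixes S :: "'a::complex_normed_vector \<Rightarrow>\<^sub>L 'a"
  assumes "S \<in> bounded_ops"
  shows "closed (kernel S)" "csubspace (kernel S)"
proof -
  show "closed (kernel S)"
    unfolding kernel_def
    by (intro closed_Collect_eq linear_continuous_on blinfun.bounded_linear_right continuous_on_const)
  show "csubspace (kernel S)"
    using assms by (auto simp: complex_vector.subspace_def kernel_def blinfun.add_right bounded_ops_scaleC)
qed

lemma csubspace_range_blinfun:
  fixes S :: "'a::complex_normed_vector \<Rightarrow>\<^sub>L 'a"
  assumes "S \<in> bounded_ops"
  shows "csubspace (range S)"
  unfolding complex_vector.subspace_def
proof (intro conjI ballI allI)
  show "0 \<in> range S" by (metis blinfun.zero_right rangeI)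
  show "x + y \<in> range S" if "x \<in> range S" "y \<in> range S" for x y
    using that by (auto simp flip: blinfun.add_right)
  show "c *\<^sub>C x \<in> range S" if "x \<in> range S" for c x
    using that bounded_ops_scaleC[OF assms, of c, symmetric] by auto
qed

text \<open>One inclusion applies \<open>S\<close> to \<open>T (S x) = 0\<close> and uses
  \<open>S (T (S x)) = S x\<close>; the other needs only \<open>T 0 = 0\<close>, which comes from
  linearity on \<open>D\<close>.\<close>

lemma kernel_proj_P:
  assumes lin: "linear_op_on D T" and S: "generalized_inverse D T S"
  shows "kernel (proj_P T S) = kernel S"
proof -
  have "T (c *\<^sub>C x) = c *\<^sub>C T x" if "x \<in> D" for c x
    using lin that by (auto simp: linear_op_on_def)
  moreover have "0 \<in> D" using lin by (auto simp: linear_op_on_def complex_vector.subspace_def)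
  ultimately have "T 0 = 0" by (metis complex_vector.scale_zero_left)
  then show ?thesis
    using generalized_inverse_inner[OF S] unfolding kernel_def proj_P_def
    by (metis blinfun.zero_right)
qed

lemma proj_Q_fixes_range:
  fixes T :: "'a::complex_banach \<Rightarrow> 'a"
  assumes "linear_op_on D T" "closure D = UNIV" and S: "generalized_inverse D T S"
  shows "proj_Q D T S (S x) = S x"
  using proj_Q_props(2)[OF assms generalized_inverse_in_domain[OF S]] generalized_inverse_inner[OF S]
  by simp

text \<open>On \<open>D\<close> the extension takes values in \<open>range S\<close>, which it
  fixes. Both sides are continuous and \<open>D\<close> is dense, so the identity spreads to the
  whole space.\<close>

lemma proj_Q_idem:
  fixes T :: "'a::complex_banach \<Rightarrow> 'a"
  assumes lin: "linear_op_on D T" and dense: "closure D = UNIV" and S: "generalized_inverse D T S"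
  shows "proj_Q D T S (proj_Q D T S x) = proj_Q D T S x"
proof (rule dense_eqI[OF dense, where x = x])
  show "proj_Q D T S (proj_Q D T S x) = proj_Q D T S x" if "x \<in> D" for x
    by (simp add: that proj_Q_props(2)[OF assms] proj_Q_fixes_range[OF assms])
qed (auto intro!: continuous_intros)

text \<open>Continuity carries the inclusion of the image of \<open>D\<close> in
  \<open>range S\<close> over to closures. Conversely, the range of an idempotent is its fixed-point
  set, which is closed and contains \<open>range S\<close>.\<close>

lemma range_proj_Q_eq_closure:
  fixes T :: "'a::complex_banach \<Rightarrow> 'a"
  assumes lin: "linear_op_on D T" and dense: "closure D = UNIV" and S: "generalized_inverse D T S"
  shows "range (proj_Q D T S) = closure (range S)"
proof
  have "proj_Q D T S ` closure D \<subseteq> closure (proj_Q D T S ` D)"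
    by (intro image_closure_subset) (auto intro!: continuous_intros closure_subset)
  also have "\<dots> \<subseteq> closure (range S)"
    by (intro closure_mono) (auto simp: proj_Q_props(2)[OF assms])
  finally show "range (proj_Q D T S) \<subseteq> closure (range S)" by (simp add: dense)
  have "range (proj_Q D T S) = {x. proj_Q D T S x = x}"
    using proj_Q_idem[OF assms] by (auto intro: range_eqI[OF sym])
  moreover have "closed {x. proj_Q D T S x = x}"
    by (intro closed_Collect_eq continuous_intros)
  ultimately show "closure (range S) \<subseteq> range (proj_Q D T S)"
    using proj_Q_fixes_range[OF assms] by (intro closure_minimal) auto
qed

section \<open>Algebra of the resolvent identity\<close>

lemma resolvent_identity_if_kernel_range_eq:
  fixes T :: "'a::complex_banach \<Rightarrow> 'a"
  assumes lin: "linear_op_on D T" and dense: "closure D = UNIV"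
    and A: "generalized_inverse D (shift_op T \<zeta>) A" and B: "generalized_inverse D (shift_op T \<mu>) B"
    and ker: "kernel A = kernel B"
    and ran: "range (proj_Q D (shift_op T \<zeta>) A) = range (proj_Q D (shift_op T \<mu>) B)"
  shows "A - B = (\<zeta> - \<mu>) *\<^sub>C (A o\<^sub>L B)"
proof (rule blinfun_eqI)
  fix x
  have B0: "B (x - shift_op T \<mu> (B x)) = 0"
    by (simp add: blinfun.diff_right generalized_inverse_inner[OF B])
  then have "A (x - shift_op T \<mu> (B x)) = 0"
    using ker by (auto simp: kernel_def)
  then have 1: "A (shift_op T \<mu> (B x)) = A x" by (simp add: blinfun.diff_right)
  \<comment> \<open>The common range consists of fixed points of the projection belonging to
    \<open>A\<close>. As \<open>B x\<close> lies in \<open>D\<close>, the extension may be evaluated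
    there as the literal product.\<close>
  have "B x \<in> range (proj_Q D (shift_op T \<zeta>) A)"
    using proj_Q_fixes_range[OF linear_op_on_shift_op[OF lin] dense B, of x] ran by (metis rangeI)
  then have "proj_Q D (shift_op T \<zeta>) A (B x) = B x"
    using proj_Q_idem[OF linear_op_on_shift_op[OF lin] dense A] by auto
  then have 2: "A (shift_op T \<zeta> (B x)) = B x"
    using proj_Q_props(2)[OF linear_op_on_shift_op[OF lin] dense A generalized_inverse_in_domain[OF B]]
    by simp
  have "A x - B x = A (shift_op T \<mu> (B x) - shift_op T \<zeta> (B x))"
    by (simp only: blinfun.diff_right 1 2)
  also have "\<dots> = A ((\<zeta> - \<mu>) *\<^sub>C B x)"
    by (simp add: shift_op_def complex_vector.scale_left_diff_distrib)
  finally show "(A - B) x = ((\<zeta> - \<mu>) *\<^sub>C (A o\<^sub>L B)) x"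
    using generalized_inverse_bounded_ops[OF A]
    by (simp add: blinfun.diff_left scaleC_blinfun.rep_eq bounded_ops_scaleC)
qed

text \<open>The identity reads both as A = (I + (\<zeta> - \<mu>)A)B and as B = A(I - (\<zeta> -
  \<mu>)B). Exchanging the roles of \<open>A\<close> and \<open>B\<close> later turns the inclusions
  into equalities.\<close>

lemma kernel_range_subset_if_resolvent_identity:
  fixes A B :: "'a::complex_normed_vector \<Rightarrow>\<^sub>L 'a"
  assumes A: "A \<in> bounded_ops" and AB: "A - B = (\<zeta> - \<mu>) *\<^sub>C (A o\<^sub>L B)"
  shows "kernel B \<subseteq> kernel A" "range B \<subseteq> range A"
proof -
  have eq: "A x - B x = A ((\<zeta> - \<mu>) *\<^sub>C B x)" for x
    using arg_cong[OF AB, of "\<lambda>F. blinfun_apply F x"] A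
    by (simp add: blinfun.diff_left scaleC_blinfun.rep_eq bounded_ops_scaleC)
  show "kernel B \<subseteq> kernel A"
    using eq by (auto simp: kernel_def) (metis blinfun.zero_right complex_vector.scale_zero_right diff_zero)
  have "B x = A (x - (\<zeta> - \<mu>) *\<^sub>C B x)" for x
    using eq[of x] by (simp add: blinfun.diff_right blinfun.add_right algebra_simps)
  then show "range B \<subseteq> range A" by auto
qed

text \<open>Insert B = S + \<mu>SB into \<zeta>AB and replace \<zeta>AS by A - S, both at
  \<open>x\<close> and at \<open>B x\<close>. The two hypotheses carry \<open>S\<close> on opposite
  sides; in the application \<open>S\<close> is \<open>R 0\<close>.\<close>

lemma resolvent_identity_if_base:
  fixes A B S :: "'a::complex_normed_vector \<Rightarrow>\<^sub>L 'a"
  assumes A: "A \<in> bounded_ops"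
    and AS: "A - S = \<zeta> *\<^sub>C (A o\<^sub>L S)" and SB: "B - S = \<mu> *\<^sub>C (S o\<^sub>L B)"
  shows "A - B = (\<zeta> - \<mu>) *\<^sub>C (A o\<^sub>L B)"
proof (rule blinfun_eqI)
  fix x
  have A1: "\<zeta> *\<^sub>C A (S y) = A y - S y" for y
    using arg_cong[OF AS, of "\<lambda>F. blinfun_apply F y"] by (simp add: blinfun.diff_left scaleC_blinfun.rep_eq)
  have B1: "B x - S x = \<mu> *\<^sub>C S (B x)"
    using arg_cong[OF SB, of "\<lambda>F. blinfun_apply F x"] by (simp add: blinfun.diff_left scaleC_blinfun.rep_eq)
  have "\<zeta> *\<^sub>C A (B x) = \<zeta> *\<^sub>C A (S x + \<mu> *\<^sub>C S (B x))"
    by (simp add: B1[symmetric])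
  also have "\<dots> = \<zeta> *\<^sub>C A (S x) + \<mu> *\<^sub>C (\<zeta> *\<^sub>C A (S (B x)))"
    using A by (simp add: blinfun.add_right bounded_ops_scaleC scaleC_add_right scaleC_scaleC mult.commute)
  also have "\<dots> = A x - S x + \<mu> *\<^sub>C A (B x) - \<mu> *\<^sub>C S (B x)"
    by (simp add: A1 complex_vector.scale_right_diff_distrib)
  also have "\<dots> = A x - B x + \<mu> *\<^sub>C A (B x)"
    by (simp add: B1[symmetric])
  finally show "(A - B) x = ((\<zeta> - \<mu>) *\<^sub>C (A o\<^sub>L B)) x"
    by (simp add: blinfun.diff_left scaleC_blinfun.rep_eq complex_vector.scale_left_diff_distrib)
qed

section \<open>Power series composed with a fixed operator\<close>

lemma powser_compose_right_sums:
  fixes A :: "nat \<Rightarrow> 'a::complex_normed_vector \<Rightarrow>\<^sub>L 'a"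
  assumes "(\<lambda>n. z ^ n *\<^sub>C A n) sums F"
  shows "(\<lambda>n. z ^ Suc n *\<^sub>C (A n o\<^sub>L S)) sums (z *\<^sub>C (F o\<^sub>L S))"
proof -
  have "(\<lambda>n. z *\<^sub>C ((z ^ n *\<^sub>C A n) o\<^sub>L S)) sums (z *\<^sub>C (F o\<^sub>L S))"
    using assms
    by (intro bounded_linear.sums[OF bounded_linear_scaleC_right]
        bounded_linear.sums[OF bounded_bilinear.bounded_linear_left[OF bounded_bilinear_blinfun_compose]])
  moreover have "z *\<^sub>C ((z ^ n *\<^sub>C A n) o\<^sub>L S) = z ^ Suc n *\<^sub>C (A n o\<^sub>L S)" for n
    by (rule blinfun_eqI) (simp add: scaleC_blinfun.rep_eq scaleC_scaleC)
  ultimately show ?thesis by simp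
qed

text \<open>Moving the complex scalar \<open>z ^ n\<close> through \<open>S\<close> requires complex
  linearity, hence \<open>S \<in> bounded_ops\<close>; for composition on the right the scalar is
  already outside.\<close>

lemma powser_compose_left_sums:
  fixes A :: "nat \<Rightarrow> 'a::complex_normed_vector \<Rightarrow>\<^sub>L 'a"
  assumes S: "S \<in> bounded_ops" and "(\<lambda>n. z ^ n *\<^sub>C A n) sums F"
  shows "(\<lambda>n. z ^ Suc n *\<^sub>C (S o\<^sub>L A n)) sums (z *\<^sub>C (S o\<^sub>L F))"
proof -
  have "(\<lambda>n. z *\<^sub>C (S o\<^sub>L (z ^ n *\<^sub>C A n))) sums (z *\<^sub>C (S o\<^sub>L F))"
    using assms(2)
    by (intro bounded_linear.sums[OF bounded_linear_scaleC_right]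
        bounded_linear.sums[OF bounded_bilinear.bounded_linear_right[OF bounded_bilinear_blinfun_compose]])
  moreover have "z *\<^sub>C (S o\<^sub>L (z ^ n *\<^sub>C A n)) = z ^ Suc n *\<^sub>C (S o\<^sub>L A n)" for n
    using S by (intro blinfun_eqI) (simp add: scaleC_blinfun.rep_eq scaleC_scaleC bounded_ops_scaleC)
  ultimately show ?thesis by simp
qed

lemma powser_eq_on_ball_imp_coeff_eq:
  fixes a b :: "nat \<Rightarrow> 'a::{complex_normed_vector,banach}"
  assumes "r > 0" and a: "\<And>z. z \<in> ball 0 r \<Longrightarrow> (\<lambda>n. z ^ n *\<^sub>C a n) sums f z"
    and b: "\<And>z. z \<in> ball 0 r \<Longrightarrow> (\<lambda>n. z ^ n *\<^sub>C b n) sums f z"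
  shows "a n = b n"
proof -
  have "a n - b n = 0"
  proof (rule powser_eq_zero_imp_coeff_eq_zero[OF assms(1)])
    show "(\<lambda>n. z ^ n *\<^sub>C (a n - b n)) sums 0" if "z \<in> ball 0 r" for z
      using sums_diff[OF a[OF that] b[OF that]] by (simp add: complex_vector.scale_right_diff_distrib)
  qed
  then show ?thesis by simp
qed

section \<open>Two cycles of implications among the five conditions\<close>

theorem theorem2p6:
  fixes U :: "complex set"
    and D :: "'a::complex_banach set"
    and T :: "'a \<Rightarrow> 'a"
    and R :: "complex \<Rightarrow> 'a \<Rightarrow>\<^sub>L 'a"
    and Tn :: "nat \<Rightarrow> 'a \<Rightarrow>\<^sub>L 'a"
    and P :: "complex \<Rightarrow> 'a \<Rightarrow> 'a"
    and Q :: "complex \<Rightarrow> 'a \<Rightarrow>\<^sub>L 'a"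
  assumes U: "open U" "connected U" "0 \<in> U"
    and T: "closed_densely_defined D T"
    and R: "analytic_generalized_inverse U D T R"
    and Tn: "range Tn \<subseteq> bounded_ops"
    and series: "\<And>\<zeta>. \<zeta> \<in> U \<Longrightarrow> (\<lambda>n. \<zeta> ^ n *\<^sub>C Tn n) sums R \<zeta>"
    and P: "\<And>\<zeta>. \<zeta> \<in> U \<Longrightarrow> P \<zeta> = proj_P (shift_op T \<zeta>) (R \<zeta>)"
    and Q: "\<And>\<zeta>. \<zeta> \<in> U \<Longrightarrow> Q \<zeta> = proj_Q D (shift_op T \<zeta>) (R \<zeta>)"
  shows
    "let i = (\<forall>n\<ge>1. blinfun_apply (Tn n) = blinfun_apply (Tn 0) ^^ (n + 1));
         ii = (\<forall>\<zeta>\<in>U. kernel (P \<zeta>) = kernel (proj_P T (Tn 0)) \<and>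
                      range (Q \<zeta>) = range (proj_Q D T (Tn 0)));
         iii = (\<exists>Z W. csubspace Z \<and> closed Z \<and> csubspace W \<and> closed W \<and>
                  (\<forall>\<zeta>\<in>U. kernel (P \<zeta>) = Z \<and> range (Q \<zeta>) = W));
         iv = generalized_resolvent U D T R;
         v = (\<forall>\<zeta>\<in>U. R \<zeta> - R 0 = \<zeta> *\<^sub>C (R \<zeta> o\<^sub>L R 0))
     in (i \<longleftrightarrow> ii) \<and> (ii \<longleftrightarrow> iii) \<and> (iii \<longleftrightarrow> iv) \<and> (iv \<longleftrightarrow> v)"
proof -
  have lin: "linear_op_on D T" and dense: "closure D = UNIV"
    using T by (auto simp: closed_densely_defined_def)
  note lins = linear_op_on_shift_op[OF lin]
  have gi: "generalized_inverse D (shift_op T \<zeta>) (R \<zeta>)" if "\<zeta> \<in> U" for \<zeta>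
    using R that by (auto simp: analytic_generalized_inverse_def)
  note bo = generalized_inverse_bounded_ops[OF gi]
  \<comment> \<open>Since \<open>0 ^ 0 = 1\<close>, only the constant term survives at 0.\<close>
  have "(\<lambda>n. 0 ^ n *\<^sub>C Tn n) sums Tn 0"
    using sums_finite[of "{0}" "\<lambda>n. 0 ^ n *\<^sub>C Tn n"] by (simp add: scaleC_one power_0_left)
  then have R0: "R 0 = Tn 0" using series[OF U(3)] sums_unique2 by blast
  have kerP: "kernel (P \<zeta>) = kernel (R \<zeta>)" if "\<zeta> \<in> U" for \<zeta>
    using kernel_proj_P[OF lins gi] that by (simp add: P)
  have ranQ: "range (Q \<zeta>) = closure (range (R \<zeta>))" if "\<zeta> \<in> U" for \<zeta>
    using range_proj_Q_eq_closure[OF lins dense gi] that by (simp add: Q)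
  have P0: "proj_P T (Tn 0) = P 0" and Q0: "proj_Q D T (Tn 0) = Q 0"
    using P[OF U(3)] Q[OF U(3)] by (simp_all add: shift_op_0 R0)
  have tail: "(\<lambda>n. \<zeta> ^ Suc n *\<^sub>C Tn (Suc n)) sums (R \<zeta> - R 0)" if "\<zeta> \<in> U" for \<zeta>
    using sums_split_initial_segment[OF series[OF that], of 1] by (simp add: R0 scaleC_one)

  define i where "i \<longleftrightarrow> (\<forall>n\<ge>1. blinfun_apply (Tn n) = blinfun_apply (Tn 0) ^^ (n + 1))"
  define ii where "ii \<longleftrightarrow> (\<forall>\<zeta>\<in>U. kernel (P \<zeta>) = kernel (proj_P T (Tn 0)) \<and>
    range (Q \<zeta>) = range (proj_Q D T (Tn 0)))"
  define iii where "iii \<longleftrightarrow> (\<exists>Z W. csubspace Z \<and> closed Z \<and> csubspace W \<and> closed W \<and>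
    (\<forall>\<zeta>\<in>U. kernel (P \<zeta>) = Z \<and> range (Q \<zeta>) = W))"
  define iv where "iv \<longleftrightarrow> generalized_resolvent U D T R"
  define v where "v \<longleftrightarrow> (\<forall>\<zeta>\<in>U. R \<zeta> - R 0 = \<zeta> *\<^sub>C (R \<zeta> o\<^sub>L R 0))"

  have i_iv: iv if i
  proof -
    \<comment> \<open>The case \<open>n = 0\<close> is trivial, so (i) holds for all indices.
      Splitting a power of \<open>Tn 0\<close> at either end then gives the recursions
      \<open>right\<close> and \<open>left\<close>.\<close>
    have pow: "blinfun_apply (Tn n) = blinfun_apply (Tn 0) ^^ Suc n" for n
      using \<open>i\<close> by (cases "n = 0") (auto simp: i_def)
    have right: "Tn (Suc n) = Tn n o\<^sub>L Tn 0" for n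
      by (rule blinfun_eqI) (simp only: pow[of "Suc n"] pow[of n] blinfun_apply_blinfun_compose
          funpow_Suc_right o_apply)
    have left: "Tn (Suc n) = Tn 0 o\<^sub>L Tn n" for n
      by (rule blinfun_eqI) (simp add: pow[of "Suc n"] pow[of n])
    have "R \<zeta> - R 0 = \<zeta> *\<^sub>C (R \<zeta> o\<^sub>L R 0)" "R \<zeta> - R 0 = \<zeta> *\<^sub>C (R 0 o\<^sub>L R \<zeta>)" if "\<zeta> \<in> U" for \<zeta>
      using sums_unique2[OF tail[OF that, unfolded right] powser_compose_right_sums[OF series[OF that]]]
        sums_unique2[OF tail[OF that, unfolded left]
          powser_compose_left_sums[OF bo[OF U(3), unfolded R0] series[OF that]]]
      by (simp_all add: R0)
    then show iv
      using U gi bo by (auto simp: iv_def generalized_resolvent_def intro!: resolvent_identity_if_base)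
  qed
  have v_i: i if v
  proof -
    obtain r where r: "r > 0" "ball 0 r \<subseteq> U" using U by (auto simp: open_contains_ball)
    \<comment> \<open>Padding with a zero constant term turns the two series in
      \<open>z ^ Suc n\<close> into power series whose coefficients can be compared.\<close>
    define a where "a = case_nat 0 (\<lambda>n. Tn (Suc n))"
    define b where "b = case_nat 0 (\<lambda>n. Tn n o\<^sub>L Tn 0)"
    have "(\<lambda>n. z ^ n *\<^sub>C a n) sums (R z - R 0)" "(\<lambda>n. z ^ n *\<^sub>C b n) sums (R z - R 0)"
      if "z \<in> ball 0 r" for z
    proof -
      have z: "z \<in> U" using that r by auto
      then have vz: "R z - R 0 = z *\<^sub>C (R z o\<^sub>L R 0)" using \<open>v\<close> by (simp add: v_def)
      show "(\<lambda>n. z ^ n *\<^sub>C a n) sums (R z - R 0)"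
        using tail[OF z] by - (rule sums_Suc_imp, simp_all add: a_def)
      show "(\<lambda>n. z ^ n *\<^sub>C b n) sums (R z - R 0)"
        using powser_compose_right_sums[OF series[OF z], of "Tn 0"] vz
        by - (rule sums_Suc_imp, simp_all add: b_def R0)
    qed
    then have "a n = b n" for n by (rule powser_eq_on_ball_imp_coeff_eq[OF r(1)])
    from this[of "Suc _"] have step: "Tn (Suc n) = Tn n o\<^sub>L Tn 0" for n by (simp add: a_def b_def)
    have "blinfun_apply (Tn n) = blinfun_apply (Tn 0) ^^ Suc n" for n
    proof (induction n)
      case (Suc n)
      show ?case
        by (rule ext) (simp only: step Suc blinfun_apply_blinfun_compose funpow_Suc_right[of "Suc n"] o_apply)
    qed simp
    then show i unfolding i_def Suc_eq_plus1 by blast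
  qed
  have iv_ii: ii if iv
  proof -
    have "kernel (R \<zeta>) = kernel (R 0) \<and> range (R \<zeta>) = range (R 0)" if z: "\<zeta> \<in> U" for \<zeta>
    proof -
      have *: "R \<zeta> - R \<mu> = (\<zeta> - \<mu>) *\<^sub>C (R \<zeta> o\<^sub>L R \<mu>)" if "\<zeta> \<in> U" "\<mu> \<in> U" for \<zeta> \<mu>
        using \<open>iv\<close> that by (auto simp: iv_def generalized_resolvent_def)
      show ?thesis
        using kernel_range_subset_if_resolvent_identity[OF bo[OF z] *[OF z U(3)]]
          kernel_range_subset_if_resolvent_identity[OF bo[OF U(3)] *[OF U(3) z]] by auto
    qed
    then show ii using U(3) kerP ranQ unfolding ii_def P0 Q0 by metis
  qed
  have ii_iii: iii if ii
  proof -
    \<comment> \<open>The witnesses for (iii) are the kernel of \<open>P 0\<close> and the range of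
      \<open>Q 0\<close>. That range is a subspace because the extension is complex-linear, and
      closed because it equals the closure of \<open>range (R 0)\<close>.\<close>
    have "csubspace (range (Q 0))"
      using csubspace_range_blinfun[OF proj_Q_props(1)[OF lins dense gi]] U(3) by (simp add: Q)
    then have "csubspace (kernel (P 0)) \<and> closed (kernel (P 0)) \<and> csubspace (range (Q 0)) \<and> closed (range (Q 0))"
      using kernel_blinfun_closed_csubspace[OF bo[OF U(3)]] kerP[OF U(3)] ranQ[OF U(3)] by simp
    then show iii using \<open>ii\<close> unfolding ii_def iii_def P0 Q0 by blast
  qed
  have iii_iv: iv if iii
  proof -
    have "R \<zeta> - R \<mu> = (\<zeta> - \<mu>) *\<^sub>C (R \<zeta> o\<^sub>L R \<mu>)" if "\<zeta> \<in> U" "\<mu> \<in> U" for \<zeta> \<mu>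
    proof (rule resolvent_identity_if_kernel_range_eq[OF lin dense gi gi])
      show "kernel (R \<zeta>) = kernel (R \<mu>)" using \<open>iii\<close> that kerP unfolding iii_def by metis
      show "range (proj_Q D (shift_op T \<zeta>) (R \<zeta>)) = range (proj_Q D (shift_op T \<mu>) (R \<mu>))"
        using \<open>iii\<close> that Q unfolding iii_def by metis
    qed (use that in auto)
    then show iv using U gi by (simp add: iv_def generalized_resolvent_def)
  qed
  have iv_v: v if iv
    using that U(3) by (auto simp: iv_def v_def generalized_resolvent_def)
  \<comment> \<open>The cycles iv, ii, iii, iv and iv, v, i, iv share (iv), so together they link
    all five conditions.\<close>
  have "(i \<longleftrightarrow> ii) \<and> (ii \<longleftrightarrow> iii) \<and> (iii \<longleftrightarrow> iv) \<and> (iv \<longleftrightarrow> v)"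
    using i_iv v_i iv_ii ii_iii iii_iv iv_v by blast
  then show ?thesis unfolding Let_def i_def ii_def iii_def iv_def v_def .
qed

end
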